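(* (i) For $n\in\{1,2,3\}$, every finite set of rectangular polyominoes is strongly $n$-Noetherian. (ii) For $n\in\mathbb{N}$, if $\mathcal{L}$ is a finite set consisting only of rectangular polyominoes of height $1$ or height at least $n-1$, then $\mathcal{L}$ is strongly $n$-Noetherian. (iii) If $n=4$ and $\mathcal{L}$ is a finite set of rectangular polyominoes such that all polyominoes of height two in $\mathcal{L}$ have the same width, then $\mathcal{L}$ is $4$-Noetherian.
   Context: A polyomino is a region of $\mathbb{R}^2$ made of unit squares joined along coincident edges, considered up to translation. $R_{n\times m}$ denotes the rectangular region of height $n$ and width $m$. A tiling of $R_{n\times m}$ by a multiset $T$ of polyominoes is a placement of translates of all elements of $T$ in $R_{n\times m}$ covering every point, with no two different elements having two-dimensional overlap; a tiling by elements of $\mathcal{L}$ is a tiling by a multiset with elements drawn from $\mathcal{L}$. A rearrangement of a tiling by $T$ is any tiling of $R_{n\times m}$ by the same multiset $T$; a rearrangement with rotations is any tiling of $R_{n\times m}$ by a multiset obtained from $T$ by replacing any of its elements by rotated copies, independently of each other. A tiling of $R_{n\times m}$ admits a subtiling (respectively, a subtiling allowing rotations) if it has a rearrangement (respectively, a rearrangement with rotations) which is the side-by-side juxtaposition of a tiling of $R_{n\times m'}$ and a tiling of $R_{n\times m''}$ with $m=m'+m''$, $m',m''\neq 0$. $\beta_n(\mathcal{L})$ is the smallest natural number such that every tiling of $R_{n\times m}$ by elements of $\mathcal{L}$ with $m>\beta_n(\mathcal{L})$ admits a subtiling, and $\infty$ if no such number exists; $\beta_n^R(\mathcal{L})$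 is defined in the same way using subtilings allowing rotations. $\mathcal{L}$ is strongly $n$-Noetherian if $\beta_n(\mathcal{L})<\infty$ and $n$-Noetherian if $\beta_n^R(\mathcal{L})<\infty$. *)

theory Defs
  imports "HOL-Analysis.Analysis" "HOL-Library.Multiset" "HOL-Library.Extended_Nat"
begin

text \<open>Points of the plane are pairs (horizontal coordinate, vertical coordinate).\<close>

type_synonym region = "(real \<times> real) set"

definition unit_square :: "int \<times> int \<Rightarrow> region" where
  "unit_square c = {of_int (fst c)..of_int (fst c) + 1} \<times> {of_int (snd c)..of_int (snd c) + 1}"

definition edge_adjacent :: "int \<times> int \<Rightarrow> int \<times> int \<Rightarrow> bool" where
  "edge_adjacent c d \<longleftrightarrow> \<bar>fst c - fst d\<bar> + \<bar>snd c - snd d\<bar> = 1"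

definition edge_connected :: "(int \<times> int) set \<Rightarrow> bool" where
  "edge_connected S \<longleftrightarrow>
     (\<forall>c\<in>S. \<forall>d\<in>S. (c, d) \<in> {(a, b). a \<in> S \<and> b \<in> S \<and> edge_adjacent a b}\<^sup>*)"

text \<open>A polyomino is considered up to translation, so it is represented by the set of all
  translates (by arbitrary real vectors) of a region.\<close>

definition translation_class :: "region \<Rightarrow> region set" where
  "translation_class X = range (\<lambda>v. (+) v ` X)"

definition polyomino :: "region set \<Rightarrow> bool" where
  "polyomino P \<longleftrightarrow>
     (\<exists>S. finite S \<and> S \<noteq> {} \<and> edge_connected S \<and> P = translation_class (\<Union> (unit_square ` S)))"

text \<open>Height first, width second.\<close>

definition rectangle :: "nat \<Rightarrow> nat \<Rightarrow> region" where
  "rectangle n m = {0..real m} \<times> {0..real n}"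

definition rect_polyomino :: "nat \<Rightarrow> nat \<Rightarrow> region set" where
  "rect_polyomino h w = translation_class (rectangle h w)"

definition rectangular :: "region set \<Rightarrow> bool" where
  "rectangular P \<longleftrightarrow> (\<exists>h w. h \<ge> 1 \<and> w \<ge> 1 \<and> P = rect_polyomino h w)"

text \<open>A tiling is given by the set of its placed pieces. No multiplicities are lost: two coinciding
  pieces would have a two-dimensional overlap.\<close>

definition tiling :: "nat \<Rightarrow> nat \<Rightarrow> region set \<Rightarrow> bool" where
  "tiling n m D \<longleftrightarrow>
     finite D \<and> (\<forall>X\<in>D. polyomino (translation_class X)) \<and> \<Union> D = rectangle n m \<and>
     (\<forall>X\<in>D. \<forall>Y\<in>D. X \<noteq> Y \<longrightarrow> interior (X \<inter> Y) = {})"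

definition pieces :: "region set \<Rightarrow> region set multiset" where
  "pieces D = image_mset translation_class (mset_set D)"

definition tiling_by :: "nat \<Rightarrow> nat \<Rightarrow> region set multiset \<Rightarrow> region set \<Rightarrow> bool" where
  "tiling_by n m T D \<longleftrightarrow> tiling n m D \<and> pieces D = T"

definition tiling_from :: "nat \<Rightarrow> nat \<Rightarrow> region set set \<Rightarrow> region set \<Rightarrow> bool" where
  "tiling_from n m L D \<longleftrightarrow> (\<exists>T. set_mset T \<subseteq> L \<and> tiling_by n m T D)"

definition quarter_turn :: "real \<times> real \<Rightarrow> real \<times> real" where
  "quarter_turn p = (- snd p, fst p)"

definition rotated_copy :: "region set \<Rightarrow> region set \<Rightarrow> bool" where
  "rotated_copy P Q \<longleftrightarrow> (\<exists>k::nat. Q = (\<lambda>X. (quarter_turn ^^ k) ` X) ` P)"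

definition rearrangement :: "nat \<Rightarrow> nat \<Rightarrow> region set \<Rightarrow> region set \<Rightarrow> bool" where
  "rearrangement n m D D' \<longleftrightarrow> tiling_by n m (pieces D) D'"

definition rearrangement_rot :: "nat \<Rightarrow> nat \<Rightarrow> region set \<Rightarrow> region set \<Rightarrow> bool" where
  "rearrangement_rot n m D D' \<longleftrightarrow>
     (\<exists>T'. rel_mset rotated_copy (pieces D) T' \<and> tiling_by n m T' D')"

definition juxtapose :: "nat \<Rightarrow> region set \<Rightarrow> region set \<Rightarrow> region set" where
  "juxtapose m' D1 D2 = D1 \<union> (\<lambda>X. (+) (real m', 0) ` X) ` D2"

definition splits :: "nat \<Rightarrow> nat \<Rightarrow> region set \<Rightarrow> bool" where
  "splits n m D \<longleftrightarrow>
     (\<exists>m' m'' D1 D2. m = m' + m'' \<and> m' \<noteq> 0 \<and> m'' \<noteq> 0 \<and>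
        tiling n m' D1 \<and> tiling n m'' D2 \<and> D = juxtapose m' D1 D2)"

definition admits_subtiling :: "nat \<Rightarrow> nat \<Rightarrow> region set \<Rightarrow> bool" where
  "admits_subtiling n m D \<longleftrightarrow> (\<exists>D'. rearrangement n m D D' \<and> splits n m D')"

definition admits_subtiling_rot :: "nat \<Rightarrow> nat \<Rightarrow> region set \<Rightarrow> bool" where
  "admits_subtiling_rot n m D \<longleftrightarrow> (\<exists>D'. rearrangement_rot n m D D' \<and> splits n m D')"

definition subtiling_bound :: "nat \<Rightarrow> region set set \<Rightarrow> nat \<Rightarrow> bool" where
  "subtiling_bound n L b \<longleftrightarrow>
     (\<forall>m D. m > b \<and> tiling_from n m L D \<longrightarrow> admits_subtiling n m D)"

definition subtiling_bound_rot :: "nat \<Rightarrow> region set set \<Rightarrow> nat \<Rightarrow> bool" where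
  "subtiling_bound_rot n L b \<longleftrightarrow>
     (\<forall>m D. m > b \<and> tiling_from n m L D \<longrightarrow> admits_subtiling_rot n m D)"

definition beta :: "nat \<Rightarrow> region set set \<Rightarrow> enat" where
  "beta n L = (if \<exists>b. subtiling_bound n L b then enat (LEAST b. subtiling_bound n L b) else \<infinity>)"

definition beta_rot :: "nat \<Rightarrow> region set set \<Rightarrow> enat" where
  "beta_rot n L =
     (if \<exists>b. subtiling_bound_rot n L b then enat (LEAST b. subtiling_bound_rot n L b) else \<infinity>)"

definition strongly_noetherian :: "nat \<Rightarrow> region set set \<Rightarrow> bool" where
  "strongly_noetherian n L \<longleftrightarrow> beta n L < \<infinity>"

definition noetherian :: "nat \<Rightarrow> region set set \<Rightarrow> bool" where
  "noetherian n L \<longleftrightarrow> beta_rot n L < \<infinity>"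

end

theory Submission
  imports Defs
begin

text \<open>Let \<open>L\<close> be a finite set of rectangles. Cut a tiling of height \<open>n\<close> by elements of \<open>L\<close> at each
  column \<open>k\<close> along the ragged right
  boundary of the pieces starting to the left of \<open>k\<close>. Widths are bounded, so there are finitely many
  boundary profiles, and in any sufficiently long window some profile recurs, say at distance \<open>p\<close>.
  The block \<open>B\<close> between the two occurrences can be excised, since both of its sides have the same
  shape. There are finitely many possibilities for \<open>(p, B)\<close>, so a long tiling contains \<open>M\<close> disjoint
  blocks with the same \<open>p\<close> and the same multiset \<open>B\<close>, where \<open>M\<close> is a common multiple of all widths.
  Excising them all leaves a tiling of a shorter rectangle. The excised pieces tile
  a rectangle of height \<open>n\<close> and width \<open>Mp\<close>: wrapped around a cylinder of circumference \<open>p\<close>, \<open>B\<close> tiles it, and each of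
  the \<open>p\<close> unit columns of the cylinder is a stack of slices of pieces. Stretching a slice of a
  piece of width \<open>w\<close> and height \<open>h\<close> horizontally by \<open>M\<close> gives a rectangle of width \<open>M\<close>, which is tiled by \<open>M div w\<close> copies of the
  piece; the \<open>w\<close> slices of the piece together use up its \<open>M\<close> copies.\<close>

section \<open>Packings of lattice regions\<close>

datatype placed = Placed (left: int) (bottom: int) (width: nat) (height: nat)

text \<open>A unit cell is named by its lower left corner. Half-open ranges turn pieces without
  two-dimensional overlap into disjoint sets, so that a tiling becomes a partition.\<close>

definition cells :: "placed \<Rightarrow> (int \<times> int) set" where
  "cells q = {left q..<left q + int (width q)} \<times> {bottom q..<bottom q + int (height q)}"

text \<open>Positive dimensions make every \<open>cells q\<close> nonempty; hence distinct pieces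
  have distinct cell sets, and pieces of disjoint regions are distinct.\<close>

definition packing :: "placed set \<Rightarrow> (int \<times> int) set \<Rightarrow> bool" where
  "packing P R \<longleftrightarrow> finite P \<and> (\<forall>q\<in>P. 0 < width q \<and> 0 < height q) \<and>
     disjoint_family_on cells P \<and> (\<Union>q\<in>P. cells q) = R"

text \<open>Width comes first, in contrast to \<open>rect_polyomino\<close>.\<close>

definition sizes :: "placed set \<Rightarrow> (nat \<times> nat) multiset" where
  "sizes P = image_mset (\<lambda>q. (width q, height q)) (mset_set P)"

text \<open>Only the region and the multiset are kept, which is all that a rearrangement has to
  preserve.\<close>

definition tileable :: "(int \<times> int) set \<Rightarrow> (nat \<times> nat) multiset \<Rightarrow> bool" where
  "tileable R A \<longleftrightarrow> (\<exists>P. packing P R \<and> sizes P = A)"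

definition grid :: "nat \<Rightarrow> nat \<Rightarrow> (int \<times> int) set" where
  "grid n m = {0..<int m} \<times> {0..<int n}"

lemma cells_nonempty: "0 < width q \<Longrightarrow> 0 < height q \<Longrightarrow> cells q \<noteq> {}"
  by (auto simp: cells_def)

lemma packing_cells_unique:
  assumes "packing P R" "q \<in> P" "q' \<in> P" "c \<in> cells q" "c \<in> cells q'"
  shows "q = q'"
  using assms unfolding packing_def disjoint_family_on_def by blast

lemma packing_cells_subset: "packing P R \<Longrightarrow> q \<in> P \<Longrightarrow> cells q \<subseteq> R"
  by (auto simp: packing_def)

lemma packing_cells_nonempty: "packing P R \<Longrightarrow> q \<in> P \<Longrightarrow> cells q \<noteq> {}"
  using cells_nonempty by (auto simp: packing_def)

lemma packing_Un:
  assumes P: "packing P R" and Q: "packing Q S" and RS: "R \<inter> S = {}"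
  shows "packing (P \<union> Q) (R \<union> S)" "P \<inter> Q = {}"
proof -
  have sub: "cells q \<subseteq> R" if "q \<in> P" for q using packing_cells_subset[OF P that] .
  have sub': "cells q \<subseteq> S" if "q \<in> Q" for q using packing_cells_subset[OF Q that] .
  show "P \<inter> Q = {}"
  proof (rule equals0I)
    fix q assume "q \<in> P \<inter> Q"
    then have "cells q \<subseteq> R \<inter> S" "cells q \<noteq> {}"
      using sub sub' packing_cells_nonempty[OF P] by auto
    with RS show False by auto
  qed
  have "cells q \<inter> cells q' = {}" if qq: "q \<in> P \<union> Q" "q' \<in> P \<union> Q" "q \<noteq> q'" for q q'
  proof (rule equals0I)
    fix c assume c: "c \<in> cells q \<inter> cells q'"
    have "\<not> (q \<in> P \<and> q' \<in> P)" "\<not> (q \<in> Q \<and> q' \<in> Q)"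
      using c qq(3) packing_cells_unique[OF P, of q q' c] packing_cells_unique[OF Q, of q q' c] by auto
    then have "c \<in> R \<inter> S" using qq c sub sub' by auto
    then show False using RS by auto
  qed
  then show "packing (P \<union> Q) (R \<union> S)"
    using P Q unfolding packing_def disjoint_family_on_def by (simp add: UN_Un ball_Un)
qed

lemma sizes_Un: "finite P \<Longrightarrow> finite Q \<Longrightarrow> P \<inter> Q = {} \<Longrightarrow> sizes (P \<union> Q) = sizes P + sizes Q"
  by (simp add: sizes_def mset_set_Union)

lemma tileableI: "packing P R \<Longrightarrow> sizes P = A \<Longrightarrow> tileable R A"
  by (auto simp: tileable_def)

lemma tileableE:
  assumes "tileable R A"
  obtains P where "packing P R" "sizes P = A"
  using assms by (auto simp: tileable_def)

lemma tileable_Un: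
  assumes "tileable R A" "tileable S B" "R \<inter> S = {}"
  shows "tileable (R \<union> S) (A + B)"
proof -
  from assms(1) obtain P where P: "packing P R" "sizes P = A" by (rule tileableE)
  from assms(2) obtain Q where Q: "packing Q S" "sizes Q = B" by (rule tileableE)
  have "finite P" "finite Q" using P(1) Q(1) by (simp_all add: packing_def)
  from sizes_Un[OF this packing_Un(2)[OF P(1) Q(1) assms(3)]]
  have "sizes (P \<union> Q) = A + B" by (simp add: P(2) Q(2))
  then show ?thesis by (rule tileableI[OF packing_Un(1)[OF P(1) Q(1) assms(3)]])
qed

lemma tileable_empty: "tileable {} {#}"
  by (rule tileableI[of "{}"]) (simp_all add: packing_def sizes_def disjoint_family_on_def)

lemma tileable_UN:
  assumes "finite I" "disjoint_family_on R I" "\<And>i. i \<in> I \<Longrightarrow> tileable (R i) (A i)"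
  shows "tileable (\<Union>i\<in>I. R i) (\<Sum>i\<in>I. A i)"
  using assms
proof (induction I rule: finite_induct)
  case empty
  then show ?case by (simp add: tileable_empty)
next
  case (insert i I)
  have dis: "R i \<inter> (\<Union>i\<in>I. R i) = {}" "disjoint_family_on R I"
    using iffD1[OF disjoint_family_on_insert[OF insert.hyps(2)] insert.prems(1)] by simp_all
  have "tileable (\<Union>i\<in>I. R i) (\<Sum>i\<in>I. A i)"
    by (rule insert.IH[OF dis(2)]) (rule insert.prems(2), simp)
  from tileable_Un[OF insert.prems(2)[of i, simplified] this dis(1)] show ?case
    by (simp add: insert.hyps)
qed

lemma tileable_rect:
  assumes "0 < w" "0 < h"
  shows "tileable ({x..<x + int w} \<times> {y..<y + int h}) {#(w, h)#}"
  by (rule tileableI[of "{Placed x y w h}"])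
    (use assms in \<open>simp_all add: packing_def sizes_def disjoint_family_on_def cells_def\<close>)

lemma tileable_bundle:
  assumes "0 < w" "0 < h"
  shows "tileable ({x..<x + int (k * w)} \<times> {y..<y + int h}) (replicate_mset k (w, h))"
proof (induction k)
  case 0
  then show ?case by (simp add: tileable_empty)
next
  case (Suc k)
  have "tileable ({x..<x + int (k * w)} \<times> {y..<y + int h} \<union>
      {x + int (k * w)..<x + int (k * w) + int w} \<times> {y..<y + int h}) (replicate_mset k (w, h) + {#(w, h)#})"
    by (rule tileable_Un[OF Suc tileable_rect[OF assms]]) auto
  also have "{x..<x + int (k * w)} \<times> {y..<y + int h} \<union>
      {x + int (k * w)..<x + int (k * w) + int w} \<times> {y..<y + int h}
      = {x..<x + int (Suc k * w)} \<times> {y..<y + int h}"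
    unfolding Sigma_Un_distrib1[symmetric]
    by (subst ivl_disj_un_two(3)) (simp_all add: algebra_simps)
  finally show ?case by simp
qed

section \<open>Horizontal translation of packings, and bounds on their sizes\<close>

definition shift :: "int \<Rightarrow> placed \<Rightarrow> placed" where
  "shift d q = Placed (left q + d) (bottom q) (width q) (height q)"

lemma shift_simps [simp]:
  "left (shift d q) = left q + d" "bottom (shift d q) = bottom q"
  "width (shift d q) = width q" "height (shift d q) = height q"
  by (simp_all add: shift_def)

lemma cells_shift: "cells (shift d q) = {(i, j). (i - d, j) \<in> cells q}"
  by (auto simp: cells_def)

lemma inj_shift: "inj_on (shift d) P"
  by (auto simp: inj_on_def shift_def intro: placed.expand)

lemma packing_shift:
  assumes "packing P R"
  shows "packing (shift d ` P) {(i, j). (i - d, j) \<in> R}"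
proof -
  have "cells q \<inter> cells q' = {}" if qq: "q \<in> P" "q' \<in> P" "q \<noteq> q'" for q q'
    using assms qq unfolding packing_def disjoint_family_on_def by simp
  then have "disjoint_family_on cells (shift d ` P)"
    unfolding disjoint_family_on_def by (force simp: cells_shift set_eq_iff)
  moreover have "(\<Union>q\<in>shift d ` P. cells q) = {(i, j). (i - d, j) \<in> R}"
    using assms by (auto simp: cells_shift packing_def)
  ultimately show ?thesis using assms unfolding packing_def by simp
qed

lemma sizes_shift: "sizes (shift d ` P) = sizes P"
proof -
  have "mset_set (shift d ` P) = image_mset (shift d) (mset_set P)"
    by (simp add: image_mset_mset_set[OF inj_shift])
  then show ?thesis by (simp add: sizes_def image_mset.compositionality comp_def)
qed

lemma tileable_shift:
  assumes "tileable R A"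
  shows "tileable {(i, j). (i - d, j) \<in> R} A"
proof -
  from assms obtain P where "packing P R" "sizes P = A" by (rule tileableE)
  then show ?thesis using tileableI[OF packing_shift] sizes_shift by simp
qed

lemma tileable_sizes_pos:
  assumes "tileable R A" "(w, h) \<in># A"
  shows "0 < w \<and> 0 < h"
proof -
  from assms(1) obtain P where "packing P R" "sizes P = A" by (rule tileableE)
  with assms(2) show ?thesis by (auto simp: packing_def sizes_def)
qed

text \<open>Every piece occupies at least one cell. This will leave only finitely many multisets for
  a block of bounded length.\<close>

lemma tileable_size_le_card:
  assumes "tileable R A"
  shows "size A \<le> card R"
proof -
  from assms obtain P where P: "packing P R" "sizes P = A" by (rule tileableE)
  have "card R = card (\<Union>q\<in>P. cells q)" using P by (simp add: packing_def)
  also have "\<dots> = (\<Sum>q\<in>P. card (cells q))"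
    using P by (intro card_UN_disjoint') (auto simp: packing_def, simp add: cells_def)
  also have "\<dots> \<ge> (\<Sum>q\<in>P. 1)"
    using packing_cells_nonempty[OF P(1)] by (intro sum_mono) (simp add: Suc_le_eq card_gt_0_iff cells_def)
  finally show ?thesis using P by (auto simp: sizes_def)
qed

section \<open>A tiling of a strip as a walk on boundary profiles\<close>

text \<open>Each profile is measured from its own reference column, and \<open>l\<close> is the
  distance between the two columns. The region thus depends on \<open>s\<close>, \<open>t\<close>
  and \<open>l\<close> but not on its place in the strip, so a block between two equal profiles can
  be excised. The inequality keeps the boundaries from crossing.\<close>

definition ragged :: "nat \<Rightarrow> (int \<Rightarrow> int) \<Rightarrow> (int \<Rightarrow> int) \<Rightarrow> nat \<Rightarrow> (nat \<times> nat) multiset \<Rightarrow> bool" where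
  "ragged n s t l A \<longleftrightarrow> (\<forall>j\<in>{0..<int n}. s j \<le> int l + t j) \<and>
     tileable {(i, j). j \<in> {0..<int n} \<and> s j \<le> i \<and> i < int l + t j} A"

lemma ragged_empty: "ragged n s s 0 {#}"
proof -
  have "{(i, j). j \<in> {0..<int n} \<and> s j \<le> i \<and> i < int 0 + s j} = {}" by auto
  with tileable_empty have "tileable {(i, j). j \<in> {0..<int n} \<and> s j \<le> i \<and> i < int 0 + s j} {#}"
    by metis
  then show ?thesis by (simp add: ragged_def)
qed

text \<open>After translation by \<open>l\<close> the left boundary of the second region is the
  right boundary of the first. Since boundaries do not cross, the two intervals in each row join to
  a single one.\<close>

lemma ragged_append:
  assumes "ragged n s t l A" "ragged n t u k B"
  shows "ragged n s u (l + k) (A + B)"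
proof -
  let ?R = "{(i, j). j \<in> {0..<int n} \<and> s j \<le> i \<and> i < int l + t j}"
  let ?S = "{(i, j). j \<in> {0..<int n} \<and> t j \<le> i \<and> i < int k + u j}"
  let ?S' = "{(i, j). (i - int l, j) \<in> ?S}"
  have le: "s j \<le> int l + t j" "t j \<le> int k + u j" if "j \<in> {0..<int n}" for j
    using assms that by (auto simp: ragged_def)
  have "tileable (?R \<union> ?S') (A + B)"
    using assms by (intro tileable_Un tileable_shift) (auto simp: ragged_def)
  also have "?R \<union> ?S' = {(i, j). j \<in> {0..<int n} \<and> s j \<le> i \<and> i < int (l + k) + u j}" (is "_ = ?T")
  proof (rule set_eqI)
    fix c :: "int \<times> int"
    obtain i j where c: "c = (i, j)" by (cases c)
    show "c \<in> ?R \<union> ?S' \<longleftrightarrow> c \<in> ?T"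
    proof (cases "j \<in> {0..<int n}")
      case True
      then show ?thesis using le[OF True] unfolding c by simp linarith
    next
      case False
      then show ?thesis unfolding c by auto
    qed
  qed
  finally have "tileable ?T (A + B)" .
  moreover have "s j \<le> int (l + k) + u j" if "j \<in> {0..<int n}" for j
    using le[OF that] by linarith
  ultimately show ?thesis unfolding ragged_def by blast
qed

lemma ragged_chain:
  assumes "\<And>k. a \<le> k \<Longrightarrow> k < b \<Longrightarrow> ragged n (s k) (s (Suc k)) (l k) (A k)" "a \<le> b"
  shows "ragged n (s a) (s b) (\<Sum>k=a..<b. l k) (\<Sum>k=a..<b. A k)"
  using assms(2,1)
proof (induction b rule: dec_induct)
  case base
  then show ?case by (simp add: ragged_empty)
next
  case (step b)
  have "ragged n (s a) (s b) (\<Sum>k=a..<b. l k) (\<Sum>k=a..<b. A k)"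
    using step.IH step.prems by simp
  moreover have "ragged n (s b) (s (Suc b)) (l b) (A b)"
    using step.hyps step.prems by simp
  ultimately show ?case using ragged_append step.hyps by simp
qed

lemma ragged_walk:
  assumes "\<And>k. k < m \<Longrightarrow> ragged n (t k) (t (Suc k)) 1 (B k)" "a \<le> b" "b \<le> m"
  shows "ragged n (t a) (t b) (b - a) (\<Sum>i=a..<b. B i)"
proof -
  have "ragged n (t a) (t b) (\<Sum>i=a..<b. 1) (\<Sum>i=a..<b. B i)"
  proof (rule ragged_chain)
    fix k assume "a \<le> k" "k < b"
    then show "ragged n (t k) (t (Suc k)) 1 (B k)" using assms by simp
  qed (rule assms)
  then show ?thesis by simp
qed

section \<open>From packings of a rectangle to walks on profiles\<close>

lemma tileable_grid_iff_ragged: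
  assumes "\<And>j. j \<in> {0..<int n} \<Longrightarrow> s j = 0" "\<And>j. j \<in> {0..<int n} \<Longrightarrow> t j = 0"
  shows "tileable (grid n m) A \<longleftrightarrow> ragged n s t m A"
proof -
  have "{(i, j). j \<in> {0..<int n} \<and> s j \<le> i \<and> i < int m + t j} = grid n m"
    using assms unfolding grid_def by auto
  then show ?thesis unfolding ragged_def using assms by simp
qed

text \<open>The end \<open>e\<close> is the right end of the piece through the cell just left of
  \<open>x\<close> in row \<open>j\<close>. No other piece starting left of \<open>x\<close> reaches
  past \<open>e\<close> in this row, since it would contain that cell as well. For
  \<open>x = 0\<close> nothing starts further left, and \<open>e = 0\<close>.\<close>

lemma packing_row_prefix:
  assumes P: "packing P (grid n m)" and W: "\<And>q. q \<in> P \<Longrightarrow> width q \<le> W"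
    and x: "0 \<le> x" "x \<le> int m" and j: "j \<in> {0..<int n}"
  shows "\<exists>e. x \<le> e \<and> e \<le> x + int W \<and> e \<le> int m \<and>
    (\<forall>i. (\<exists>q\<in>P. left q < x \<and> (i, j) \<in> cells q) \<longleftrightarrow> 0 \<le> i \<and> i < e)"
proof (cases "x = 0")
  case True
  have "0 \<le> left q" if "q \<in> P" for q
  proof -
    have "(left q, bottom q) \<in> cells q"
      using P that by (auto simp: cells_def packing_def)
    then show ?thesis using packing_cells_subset[OF P that] by (auto simp: grid_def)
  qed
  then have "\<not> left q < x" if "q \<in> P" for q using True that by (simp add: not_less)
  then show ?thesis using True x by (intro exI[of _ 0]) auto
next
  case False
  have cover: "\<exists>q\<in>P. (i, j) \<in> cells q" if "0 \<le> i" "i < int m" for i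
  proof -
    have "(i, j) \<in> (\<Union>q\<in>P. cells q)" using P that j by (simp add: packing_def grid_def)
    then show ?thesis by simp
  qed
  obtain q where q: "q \<in> P" "(x - 1, j) \<in> cells q"
    using cover[of "x - 1"] x False by auto
  let ?e = "left q + int (width q)"
  have row: "(i, j) \<in> cells q \<longleftrightarrow> left q \<le> i \<and> i < ?e" for i
    using q(2) by (auto simp: cells_def)
  have iff: "(\<exists>q'\<in>P. left q' < x \<and> (i, j) \<in> cells q') \<longleftrightarrow> 0 \<le> i \<and> i < ?e" for i
  proof
    assume "\<exists>q'\<in>P. left q' < x \<and> (i, j) \<in> cells q'"
    then obtain q' where q': "q' \<in> P" "left q' < x" "(i, j) \<in> cells q'" by blast
    have "0 \<le> i" using packing_cells_subset[OF P q'(1)] q'(3) by (auto simp: grid_def)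
    moreover have "i < ?e"
    proof (rule ccontr)
      assume "\<not> i < ?e"
      then have "(x - 1, j) \<in> cells q'"
        using q' q(2) by (auto simp: cells_def)
      then have "q' = q" using packing_cells_unique[OF P q'(1) q(1)] q(2) by blast
      then show False using q'(3) row \<open>\<not> i < ?e\<close> by blast
    qed
    ultimately show "0 \<le> i \<and> i < ?e" by blast
  next
    assume i: "0 \<le> i \<and> i < ?e"
    show "\<exists>q'\<in>P. left q' < x \<and> (i, j) \<in> cells q'"
    proof (cases "i < x")
      case True
      then obtain q' where "q' \<in> P" "(i, j) \<in> cells q'" using cover[of i] i x by auto
      then show ?thesis using True by (intro bexI[of _ q']) (auto simp: cells_def)
    next
      case False
      then show ?thesis using i q row by (intro bexI[of _ q]) (auto simp: row)
    qed
  qed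
  have "left q \<le> x - 1" "x - 1 < ?e" using q(2) row by auto
  moreover have "?e \<le> int m"
  proof -
    have "(?e - 1, j) \<in> cells q" using row calculation by auto
    then show ?thesis using packing_cells_subset[OF P q(1)] by (auto simp: grid_def)
  qed
  moreover have "int (width q) \<le> int W" using W[OF q(1)] by simp
  ultimately show ?thesis using iff by (intro exI[of _ ?e]) auto
qed

text \<open>Extensional functions make this set finite and let equality of boundaries on the
  \<open>n\<close> rows be equality of functions.\<close>

abbreviation profiles :: "nat \<Rightarrow> nat \<Rightarrow> (int \<Rightarrow> int) set" where
  "profiles n W \<equiv> {0..<int n} \<rightarrow>\<^sub>E {0..int W}"

lemma packing_subset:
  assumes "packing P R" "Q \<subseteq> P" "(\<Union>q\<in>Q. cells q) = S"
  shows "packing Q S"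
  using assms finite_subset[of Q P] disjoint_family_on_mono[of Q P cells]
  unfolding packing_def by auto

lemma sizes_UN:
  assumes "finite I" "\<And>i. i \<in> I \<Longrightarrow> finite (P i)" "disjoint_family_on P I"
  shows "sizes (\<Union>i\<in>I. P i) = (\<Sum>i\<in>I. sizes (P i))"
  using assms
proof (induction I rule: finite_induct)
  case empty
  then show ?case by (simp add: sizes_def)
next
  case (insert i I)
  have dis: "P i \<inter> (\<Union>i\<in>I. P i) = {}" "disjoint_family_on P I"
    using iffD1[OF disjoint_family_on_insert[OF insert.hyps(2)] insert.prems(2)] by simp_all
  have fin: "finite (\<Union>i\<in>I. P i)" "finite (P i)" using insert.hyps insert.prems(1) by simp_all
  have "sizes (\<Union>i\<in>I. P i) = (\<Sum>i\<in>I. sizes (P i))"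
    by (rule insert.IH[OF _ dis(2)]) (rule insert.prems(1), simp)
  then show ?case
    using sizes_Un[OF fin(2,1) dis(1)] by (simp add: insert.hyps)
qed

lemma packing_grid_left:
  assumes P: "packing P (grid n m)" and q: "q \<in> P"
  shows "0 \<le> left q \<and> left q < int m"
proof -
  have "(left q, bottom q) \<in> cells q"
    using P q by (simp add: cells_def packing_def)
  then have "(left q, bottom q) \<in> grid n m" using packing_cells_subset[OF P q] by (rule subsetD[rotated])
  then show ?thesis by (simp add: grid_def)
qed

text \<open>Each cell lies in at most one piece, so in row \<open>j\<close> the pieces starting at
  \<open>x\<close> cover the prefix belonging to \<open>x + 1\<close> minus the prefix belonging to
  \<open>x\<close>. A difference of nested prefixes is an interval.\<close>

lemma packing_slice_row:
  assumes P: "packing P R"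
    and a: "\<And>i. (\<exists>q\<in>P. left q < x \<and> (i, j) \<in> cells q) \<longleftrightarrow> 0 \<le> i \<and> i < a" "0 \<le> a"
    and b: "\<And>i. (\<exists>q\<in>P. left q < x + 1 \<and> (i, j) \<in> cells q) \<longleftrightarrow> 0 \<le> i \<and> i < b" "0 \<le> b"
  shows "a \<le> b" "(\<exists>q\<in>P. left q = x \<and> (i, j) \<in> cells q) \<longleftrightarrow> a \<le> i \<and> i < b"
proof -
  show "a \<le> b"
  proof (rule ccontr)
    assume "\<not> a \<le> b"
    then obtain q where q: "q \<in> P" "left q < x" "(b, j) \<in> cells q" using a(1)[of b] b(2) by auto
    then have "left q < x + 1" by simp
    then show False using q b(1)[of b] by blast
  qed
  have "(\<exists>q\<in>P. left q = x \<and> (i, j) \<in> cells q) \<longleftrightarrow>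
    (\<exists>q\<in>P. left q < x + 1 \<and> (i, j) \<in> cells q) \<and> \<not> (\<exists>q\<in>P. left q < x \<and> (i, j) \<in> cells q)"
    (is "?l \<longleftrightarrow> ?r")
  proof
    assume ?l
    then obtain q where q: "q \<in> P" "left q = x" "(i, j) \<in> cells q" by blast
    have "\<not> (left r < x \<and> (i, j) \<in> cells r)" if "r \<in> P" for r
      using packing_cells_unique[OF P that q(1) _ q(3)] q(2) by auto
    moreover have "left q < x + 1" using q(2) by simp
    ultimately show ?r using q by blast
  next
    assume r: ?r
    then obtain q where q: "q \<in> P" "left q < x + 1" "(i, j) \<in> cells q" by blast
    with r have "\<not> left q < x" by blast
    then have "left q = x" using q(2) by simp
    then show ?l using q by blast
  qed
  then show "(\<exists>q\<in>P. left q = x \<and> (i, j) \<in> cells q) \<longleftrightarrow> a \<le> i \<and> i < b"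
    unfolding a(1) b(1) using a(2) by linarith
qed

text \<open>Every piece is charged to the column of its left edge. The pieces charged to column
  \<open>k\<close> fill exactly the space between the boundaries at \<open>k\<close> and
  \<open>k + 1\<close>, which is one step of the walk.\<close>

lemma tileable_grid_walk:
  assumes tile: "tileable (grid n m) A" and W: "\<And>w h. (w, h) \<in># A \<Longrightarrow> w \<le> W"
  obtains t B where "\<forall>k\<le>m. t k \<in> profiles n W"
    "\<forall>j\<in>{0..<int n}. t 0 j = 0" "\<forall>j\<in>{0..<int n}. t m j = 0"
    "\<forall>k<m. ragged n (t k) (t (Suc k)) 1 (B k)" "A = (\<Sum>k<m. B k)"
proof -
  from tile obtain P where P: "packing P (grid n m)" "sizes P = A" by (rule tileableE)
  have fin: "finite P" using P(1) by (simp add: packing_def)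
  have widths: "width q \<le> W" if "q \<in> P" for q
    using W[of "width q" "height q"] P(2) that fin by (auto simp: sizes_def)
  \<comment> \<open>Absolute position in row \<open>j\<close> of the right boundary of the pieces
    starting left of column \<open>k\<close>.\<close>
  define e where "e k j = (SOME e. int k \<le> e \<and> e \<le> int k + int W \<and> e \<le> int m \<and>
    (\<forall>i. (\<exists>q\<in>P. left q < int k \<and> (i, j) \<in> cells q) \<longleftrightarrow> 0 \<le> i \<and> i < e))" for k j
  have e: "int k \<le> e k j" "e k j \<le> int k + int W" "e k j \<le> int m"
      "(\<exists>q\<in>P. left q < int k \<and> (i, j) \<in> cells q) \<longleftrightarrow> 0 \<le> i \<and> i < e k j"
    if "k \<le> m" "j \<in> {0..<int n}" for k i j
  proof -
    have "\<exists>e. int k \<le> e \<and> e \<le> int k + int W \<and> e \<le> int m \<and>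
      (\<forall>i. (\<exists>q\<in>P. left q < int k \<and> (i, j) \<in> cells q) \<longleftrightarrow> 0 \<le> i \<and> i < e)"
      by (rule packing_row_prefix[OF P(1) widths]) (use that in simp_all)
    from someI_ex[OF this, folded e_def]
    show "int k \<le> e k j" "e k j \<le> int k + int W" "e k j \<le> int m"
      "(\<exists>q\<in>P. left q < int k \<and> (i, j) \<in> cells q) \<longleftrightarrow> 0 \<le> i \<and> i < e k j" by blast+
  qed
  have e0: "0 \<le> e k j" if "k \<le> m" "j \<in> {0..<int n}" for k j
    using e(1)[OF that] by simp
  \<comment> \<open>Subtracting \<open>k\<close> brings the boundary into the finite set
    \<open>profiles n W\<close>.\<close>
  define t where "t k = (\<lambda>j\<in>{0..<int n}. e k j - int k)" for k
  define Q where "Q k = {q \<in> P. left q = int k}" for k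
  have prof: "t k \<in> profiles n W" if "k \<le> m" for k
  proof (rule PiE_I)
    fix j assume j: "j \<in> {0..<int n}"
    show "t k j \<in> {0..int W}" using e(1,2)[OF that j] j by (simp add: t_def)
  qed (auto simp: t_def)
  have t0: "t 0 j = 0" if j: "j \<in> {0..<int n}" for j
  proof -
    have "\<not> left q < int 0" if "q \<in> P" for q using packing_grid_left[OF P(1) that] by simp
    then have "\<not> (\<exists>q\<in>P. left q < int 0 \<and> (0, j) \<in> cells q)" by blast
    then have "\<not> 0 < e 0 j" using e(4)[of 0 j 0, OF le0 j] by blast
    then show ?thesis using e(1)[of 0 j] j by (simp add: t_def)
  qed
  \<comment> \<open>For \<open>k = m\<close> the bounds \<open>int k \<le> e k j\<close> and
    \<open>e k j \<le> int m\<close> squeeze the boundary onto the right edge.\<close>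
  have tm: "t m j = 0" if j: "j \<in> {0..<int n}" for j
    using e(1,3)[OF order_refl j] j by (simp add: t_def)
  have step: "ragged n (t k) (t (Suc k)) 1 (sizes (Q k))" if k: "k < m" for k
  proof -
    have slice: "e k j \<le> e (Suc k) j"
      "(\<exists>q\<in>P. left q = int k \<and> (i, j) \<in> cells q) \<longleftrightarrow> e k j \<le> i \<and> i < e (Suc k) j"
      if j: "j \<in> {0..<int n}" for i j
    proof -
      have k': "k \<le> m" "Suc k \<le> m" using k by simp_all
      have s: "int k + 1 = int (Suc k)" by simp
      note * = packing_slice_row[OF P(1), of "int k" j "e k j" "e (Suc k) j", unfolded s,
        OF e(4)[OF k'(1) j] e0[OF k'(1) j] e(4)[OF k'(2) j] e0[OF k'(2) j]]
      show "e k j \<le> e (Suc k) j" by (rule *(1))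
      show "(\<exists>q\<in>P. left q = int k \<and> (i, j) \<in> cells q) \<longleftrightarrow> e k j \<le> i \<and> i < e (Suc k) j"
        by (rule *(2))
    qed
    \<comment> \<open>The summand 1 appears because \<open>t (Suc k)\<close> is measured from column
      \<open>k + 1\<close>, while the region is described from column \<open>k\<close>.\<close>
    let ?R = "{(i, j). j \<in> {0..<int n} \<and> t k j \<le> i - int k \<and> i - int k < int 1 + t (Suc k) j}"
    have "(\<Union>q\<in>Q k. cells q) = ?R"
    proof (rule set_eqI)
      fix c :: "int \<times> int"
      obtain i j where c: "c = (i, j)" by (cases c)
      show "c \<in> (\<Union>q\<in>Q k. cells q) \<longleftrightarrow> c \<in> ?R"
      proof (cases "j \<in> {0..<int n}")
        case False
        have "(i, j) \<notin> cells q" if "q \<in> P" for q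
          using False packing_cells_subset[OF P(1) that] unfolding grid_def by blast
        then show ?thesis using False unfolding c Q_def by auto
      next
        case True
        have "c \<in> (\<Union>q\<in>Q k. cells q) \<longleftrightarrow> e k j \<le> i \<and> i < e (Suc k) j"
          unfolding c Q_def slice(2)[OF True, symmetric] by blast
        also have "\<dots> \<longleftrightarrow> c \<in> ?R"
          using True unfolding c t_def by auto
        finally show ?thesis .
      qed
    qed
    then have "packing (Q k) ?R"
      by (rule packing_subset[OF P(1), rotated]) (simp add: Q_def)
    from tileable_shift[OF tileableI[OF this refl], of "- int k"]
    have "tileable {(i, j). j \<in> {0..<int n} \<and> t k j \<le> i \<and> i < int 1 + t (Suc k) j} (sizes (Q k))"
      by simp
    moreover have "t k j \<le> int 1 + t (Suc k) j" if "j \<in> {0..<int n}" for j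
      using slice(1)[OF that] that by (simp add: t_def)
    ultimately show ?thesis unfolding ragged_def by blast
  qed
  have "P = (\<Union>k<m. Q k)"
  proof (rule set_eqI)
    fix q
    show "q \<in> P \<longleftrightarrow> q \<in> (\<Union>k<m. Q k)"
    proof
      assume q: "q \<in> P"
      then have "q \<in> Q (nat (left q))" "nat (left q) < m"
        using packing_grid_left[OF P(1) q] by (auto simp: Q_def nat_less_iff)
      then show "q \<in> (\<Union>k<m. Q k)" by blast
    qed (simp add: Q_def)
  qed
  moreover have "disjoint_family_on Q {..<m}" by (auto simp: disjoint_family_on_def Q_def)
  ultimately have A: "A = (\<Sum>k<m. sizes (Q k))"
    using sizes_UN[of "{..<m}" Q] P(2) fin by (simp add: Q_def)
  show thesis
  proof (rule that)
    show "\<forall>k<m. ragged n (t k) (t (Suc k)) 1 (sizes (Q k))" using step by blast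
  qed (use prof t0 tm A in blast)+
qed

section \<open>Unrolling a periodic block\<close>

text \<open>Any \<open>p\<close> consecutive columns meet every column of a cylinder of
  circumference \<open>p\<close> exactly once.\<close>

lemma bij_betw_mod_interval:
  fixes a :: int and p :: nat
  assumes "0 < p"
  shows "bij_betw (\<lambda>i. i mod int p) {a..<a + int p} {0..<int p}"
proof -
  have inj: "inj_on (\<lambda>i. i mod int p) {a..<a + int p}"
  proof (rule inj_onI)
    fix i i' assume i: "i \<in> {a..<a + int p}" "i' \<in> {a..<a + int p}" "i mod int p = i' mod int p"
    then have "int p dvd i - i'" by (simp add: mod_eq_dvd_iff)
    moreover have "\<not> \<bar>int p\<bar> \<le> \<bar>i - i'\<bar>" using i(1,2) by auto
    ultimately have "i - i' = 0" using dvd_imp_le_int by metis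
    then show "i = i'" by simp
  qed
  moreover have "(\<lambda>i. i mod int p) ` {a..<a + int p} = {0..<int p}"
  proof (rule card_subset_eq)
    show "(\<lambda>i. i mod int p) ` {a..<a + int p} \<subseteq> {0..<int p}" using assms by auto
    show "card ((\<lambda>i. i mod int p) ` {a..<a + int p}) = card {0..<int p}"
      using card_image[OF inj] by simp
  qed simp
  ultimately show ?thesis by (rule bij_betw_imageI)
qed

lemma sum_const_mset: "finite I \<Longrightarrow> (\<Sum>i\<in>I. B) = repeat_mset (card I) B"
  by (induction I rule: finite_induct) simp_all

text \<open>Sliding row \<open>j\<close> by \<open>- t j\<close> carries the region into a rectangle
  of width \<open>p\<close> and height \<open>n\<close>.\<close>

lemma card_ragged_le:
  "card {(i, j). j \<in> {0..<int n} \<and> t j \<le> i \<and> i < int p + t j} \<le> n * p"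
proof -
  let ?R = "{(i, j). j \<in> {0..<int n} \<and> t j \<le> i \<and> i < int p + t j}"
  have "card ?R \<le> card ({0..<int p} \<times> {0..<int n})"
  proof (rule card_inj_on_le)
    show "inj_on (\<lambda>(i, j). (i - t j, j)) ?R" by (auto simp: inj_on_def)
  qed auto
  then show ?thesis by (simp add: mult.commute)
qed

text \<open>In each row the block occupies \<open>p\<close> consecutive columns, so residues modulo
  \<open>p\<close> identify its cells with those of the cylinder. Residue \<open>r\<close> is
  stretched to the \<open>M\<close> columns starting at \<open>M * r\<close>; distinct cells of a
  row then get disjoint intervals, which together fill the row of the large rectangle.\<close>

lemma cyclic_block_tileable:
  assumes B: "ragged n t t p B" and p: "0 < p" and M: "0 < M"
    and dvd: "\<And>w h. (w, h) \<in># B \<Longrightarrow> w dvd M"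
  shows "tileable (grid n (M * p)) (repeat_mset M B)"
proof -
  let ?R = "{(i, j). j \<in> {0..<int n} \<and> t j \<le> i \<and> i < int p + t j}"
  from B obtain P where P: "packing P ?R" "sizes P = B"
    unfolding ragged_def by (auto elim: tileableE)
  have finP: "finite P" using P by (simp add: packing_def)
  have posP: "0 < width q" "0 < height q" if "q \<in> P" for q
    using P that by (auto simp: packing_def)
  have dvdP: "width q dvd M" if "q \<in> P" for q
    using dvd[of "width q" "height q"] P(2) that finP by (auto simp: sizes_def)
  \<comment> \<open>The indices are the slices: a piece together with one of its columns.\<close>
  define I where "I = (SIGMA q:P. {left q..<left q + int (width q)})"
  define col where "col i = int M * (i mod int p)" for i
  define S where "S = (\<lambda>(q, i). {col i..<col i + int M} \<times> {bottom q..<bottom q + int (height q)})"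
  \<comment> \<open>As the width divides \<open>M\<close>, this many copies laid end to end fill the
    stretched slice.\<close>
  define C where "C = (\<lambda>(q, i::int). replicate_mset (M div width q) (width q, height q))"
  have inI: "(i, j) \<in> cells q \<longleftrightarrow> (q, i) \<in> I \<and> j \<in> {bottom q..<bottom q + int (height q)}"
    if "q \<in> P" for q i j
    using that by (auto simp: I_def cells_def)
  have bij: "bij_betw (\<lambda>i. i mod int p) {t j..<t j + int p} {0..<int p}" for j
    by (rule bij_betw_mod_interval[OF p])
  \<comment> \<open>Division by \<open>M\<close> recovers the residue from any column of a stretched
    slice, so overlapping stretched slices come from the same cell.\<close>
  have col_eq: "i mod int p = a div int M" if "a \<in> {col i..<col i + int M}" for a i
  proof (rule sym, rule int_div_pos_eq[of _ _ _ "a - col i"])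
    show "a = int M * (i mod int p) + (a - col i)" by (simp add: col_def)
  qed (use that M in auto)
  have finI: "finite I" using finP by (auto simp: I_def)
  have disj: "disjoint_family_on S I"
    unfolding disjoint_family_on_def
  proof (intro ballI impI equals0I)
    fix x y c assume x: "x \<in> I" and y: "y \<in> I" and "x \<noteq> y" and c: "c \<in> S x \<inter> S y"
    obtain q i where qi: "x = (q, i)" by (cases x)
    obtain r k where rk: "y = (r, k)" by (cases y)
    obtain a j where aj: "c = (a, j)" by (cases c)
    have c1: "a \<in> {col i..<col i + int M}" "j \<in> {bottom q..<bottom q + int (height q)}"
      and c2: "a \<in> {col k..<col k + int M}" "j \<in> {bottom r..<bottom r + int (height r)}"
      using c unfolding qi rk aj S_def by auto
    have q: "q \<in> P" and r: "r \<in> P" using x y qi rk by (auto simp: I_def)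
    have i: "(i, j) \<in> cells q" using inI[OF q] c1(2) x qi by simp
    have k: "(k, j) \<in> cells r" using inI[OF r] c2(2) y rk by simp
    have "(i, j) \<in> ?R" using packing_cells_subset[OF P(1) q] i by (rule subsetD)
    moreover have "(k, j) \<in> ?R" using packing_cells_subset[OF P(1) r] k by (rule subsetD)
    moreover have "i mod int p = k mod int p" using col_eq[OF c1(1)] col_eq[OF c2(1)] by simp
    ultimately have "i = k" using bij_betw_imp_inj_on[OF bij[of j]] by (auto dest!: inj_onD)
    then have "q = r" using packing_cells_unique[OF P(1) q r i] k by simp
    then show False using \<open>x \<noteq> y\<close> \<open>i = k\<close> qi rk by simp
  qed
  have each: "tileable (S x) (C x)" if "x \<in> I" for x
  proof -
    obtain q i where qi: "x = (q, i)" by (cases x)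
    have q: "q \<in> P" using that qi by (auto simp: I_def)
    have "M div width q * width q = M" using dvdP[OF q] by simp
    then show ?thesis
      using tileable_bundle[OF posP[OF q], of "col i" "M div width q" "bottom q"]
      by (simp add: qi S_def C_def)
  qed
  have "(\<Union>x\<in>I. S x) = grid n (M * p)"
  proof (rule set_eqI)
    fix c :: "int \<times> int"
    obtain a j where aj: "c = (a, j)" by (cases c)
    show "c \<in> (\<Union>x\<in>I. S x) \<longleftrightarrow> c \<in> grid n (M * p)"
    proof
      assume "c \<in> (\<Union>x\<in>I. S x)"
      then obtain q i where x: "(q, i) \<in> I" and c: "c \<in> S (q, i)" by auto
      have q: "q \<in> P" using x by (auto simp: I_def)
      have c1: "a \<in> {col i..<col i + int M}" "j \<in> {bottom q..<bottom q + int (height q)}"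
        using c unfolding aj S_def by auto
      have "(i, j) \<in> cells q" using inI[OF q] x c1 by simp
      then have "(i, j) \<in> ?R" using packing_cells_subset[OF P(1) q] by (rule subsetD[rotated])
      then have j: "j \<in> {0..<int n}" by simp
      have ip: "0 \<le> i mod int p" "i mod int p < int p" using p by simp_all
      then have "i mod int p + 1 \<le> int p" by linarith
      then have "0 \<le> col i" "int M * (i mod int p + 1) \<le> int M * int p"
        unfolding col_def using ip(1) by (intro mult_nonneg_nonneg mult_left_mono; simp)+
      then have "0 \<le> col i" "col i + int M \<le> int (M * p)"
        by (simp_all add: col_def distrib_left)
      then show "c \<in> grid n (M * p)" using c1(1) j unfolding aj grid_def by auto
    next
      assume "c \<in> grid n (M * p)"
      then have a: "0 \<le> a" "a < int M * int p" and j: "j \<in> {0..<int n}"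
        unfolding aj grid_def by auto
      have mod_a: "int M * (a div int M) + a mod int M = a" "0 \<le> a mod int M" "a mod int M < int M"
        using M by simp_all
      have "0 \<le> a div int M" using a(1) M by (simp add: pos_imp_zdiv_nonneg_iff)
      moreover have "a div int M < int p"
      proof (rule ccontr)
        assume "\<not> a div int M < int p"
        then have "int M * int p \<le> int M * (a div int M)" by (intro mult_left_mono) auto
        also have "\<dots> \<le> a" using mod_a by linarith
        finally show False using a(2) by simp
      qed
      \<comment> \<open>The quotient is a residue, hence it is attained by a column of the block in
        row \<open>j\<close>; the piece covering that cell yields the required slice.\<close>
      ultimately have "a div int M \<in> (\<lambda>i. i mod int p) ` {t j..<t j + int p}"
        using bij_betw_imp_surj_on[OF bij[of j]] by simp
      then obtain i where i: "i \<in> {t j..<t j + int p}" "i mod int p = a div int M" by auto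
      then have "(i, j) \<in> ?R" using j by simp
      then have "(i, j) \<in> (\<Union>q\<in>P. cells q)" using P(1) by (simp add: packing_def)
      then obtain q where q: "q \<in> P" "(i, j) \<in> cells q" by auto
      have x: "(q, i) \<in> I" "j \<in> {bottom q..<bottom q + int (height q)}" using inI[OF q(1)] q(2) by simp_all
      have "a \<in> {col i..<col i + int M}"
        unfolding col_def i(2) atLeastLessThan_iff
        using mod_a by linarith
      then have "c \<in> S (q, i)" using x(2) unfolding aj S_def by simp
      then show "c \<in> (\<Union>x\<in>I. S x)" using x(1) by (rule UN_I[rotated])
    qed
  qed
  moreover have "(\<Sum>x\<in>I. C x) = repeat_mset M B"
  proof -
    have "(\<Sum>x\<in>I. C x) = (\<Sum>q\<in>P. \<Sum>i\<in>{left q..<left q + int (width q)}. C (q, i))"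
      unfolding I_def using finP by (subst sum.Sigma) auto
    \<comment> \<open>The \<open>width q\<close> slices of a piece contribute
      \<open>M div width q\<close> copies each, altogether \<open>M\<close>.\<close>
    also have "\<dots> = (\<Sum>q\<in>P. repeat_mset M {#(width q, height q)#})"
    proof (rule sum.cong[OF refl])
      fix q assume "q \<in> P"
      then have "width q * (M div width q) = M" using dvdP by simp
      then show "(\<Sum>i\<in>{left q..<left q + int (width q)}. C (q, i)) = repeat_mset M {#(width q, height q)#}"
        by (intro multiset_eqI) (simp add: C_def sum_const_mset)
    qed
    also have "\<dots> = repeat_mset M (\<Sum>q\<in>P. {#(width q, height q)#})"
      using finP by (induction P rule: finite_induct) (simp_all add: repeat_mset_distrib2)
    also have "(\<Sum>q\<in>P. {#(width q, height q)#}) = B"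
      using finP unfolding P(2)[symmetric] sizes_def
      by (induction P rule: finite_induct) simp_all
    finally show ?thesis .
  qed
  ultimately show ?thesis
    using tileable_UN[OF finI disj each] by simp
qed

section \<open>Splitting tilings of long strips\<close>

text \<open>Pigeonhole on the \<open>V + 1\<close> indices of the window. Adjacent windows of
  \<open>V\<close> steps share an endpoint, but the blocks of steps from \<open>x\<close> to
  \<open>y - 1\<close> inside them remain disjoint.\<close>

lemma repeated_value_in_window:
  fixes t :: "nat \<Rightarrow> 'a"
  assumes "finite S" "card S \<le> V" "\<And>k. k \<in> {a..a + V} \<Longrightarrow> t k \<in> S"
  shows "\<exists>x y. a \<le> x \<and> x < y \<and> y \<le> a + V \<and> t x = t y"
proof -
  have "t ` {a..a + V} \<subseteq> S" using assms(3) by blast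
  from card_mono[OF assms(1) this] have "card (t ` {a..a + V}) < card {a..a + V}"
    using assms(2) by simp
  then have "\<not> inj_on t {a..a + V}" by (rule pigeonhole)
  then obtain x y where "x \<in> {a..a + V}" "y \<in> {a..a + V}" "x \<noteq> y" "t x = t y"
    unfolding inj_on_def by blast
  then have "a \<le> min x y \<and> min x y < max x y \<and> max x y \<le> a + V \<and> t (min x y) = t (max x y)"
    by (auto simp: min_def max_def)
  then show ?thesis by blast
qed

text \<open>Equal profiles at the ends of an excised block let the rest of its window close up,
  while the profiles at the ends of the window stay the same. The windows can therefore be shortened
  independently and chained again.\<close>

lemma remove_windows:
  assumes walk: "\<And>k. k < N * V \<Longrightarrow> ragged n (t k) (t (Suc k)) 1 (B k)"
    and J: "J \<subseteq> {..<N}"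
    and win: "\<And>k. k \<in> J \<Longrightarrow> k * V \<le> x k \<and> x k + p \<le> Suc k * V \<and> t (x k) = t (x k + p) \<and>
       (\<Sum>i=x k..<x k + p. B i) = D"
  shows "\<exists>l E. ragged n (t 0) (t (N * V)) l E \<and> l + card J * p = N * V \<and>
    E + repeat_mset (card J) D = (\<Sum>i<N * V. B i)"
proof -
  have seg: "ragged n (t a) (t b) (b - a) (\<Sum>i=a..<b. B i)" if "a \<le> b" "b \<le> N * V" for a b
    by (rule ragged_walk[OF _ that]) (rule walk)
  define l where "l k = (if k \<in> J then V - p else V)" for k
  \<comment> \<open>What remains of window \<open>k\<close>: the parts before and after the excised
    block, or the whole window.\<close>
  define E where "E k = (if k \<in> J then (\<Sum>i=k * V..<x k. B i) + (\<Sum>i=x k + p..<Suc k * V. B i)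
    else (\<Sum>i=k * V..<Suc k * V. B i))" for k
  have chain: "ragged n (t (k * V)) (t (Suc k * V)) (l k) (E k)" if "k < N" for k
  proof -
    have le: "Suc k * V \<le> N * V" using that by (intro mult_le_mono1) simp
    show ?thesis
    proof (cases "k \<in> J")
      case False
      then show ?thesis using seg[of "k * V" "Suc k * V", OF _ le] by (simp add: l_def E_def)
    next
      case True
      note w = win[OF True]
      have "ragged n (t (k * V)) (t (x k)) (x k - k * V) (\<Sum>i=k * V..<x k. B i)"
        using seg[of "k * V" "x k"] w le by simp
      moreover have "ragged n (t (x k)) (t (Suc k * V)) (Suc k * V - (x k + p)) (\<Sum>i=x k + p..<Suc k * V. B i)"
        using seg[of "x k + p" "Suc k * V"] w le by simp
      ultimately have "ragged n (t (k * V)) (t (Suc k * V)) (x k - k * V + (Suc k * V - (x k + p))) (E k)"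
        using ragged_append True by (simp add: E_def)
      moreover have "x k - k * V + (Suc k * V - (x k + p)) = l k"
        using w True by (simp add: l_def)
      ultimately show ?thesis by simp
    qed
  qed
  have p: "p \<le> V" if "k \<in> J" for k using win[OF that] by simp
  have finJ: "finite J" using J finite_subset by blast
  have "ragged n (t (0 * V)) (t (N * V)) (\<Sum>k=0..<N. l k) (\<Sum>k=0..<N. E k)"
    using chain by (intro ragged_chain[where s="\<lambda>k. t (k * V)"]) simp_all
  then have "ragged n (t 0) (t (N * V)) (\<Sum>k<N. l k) (\<Sum>k<N. E k)"
    by (simp add: atLeast0LessThan)
  moreover have "(\<Sum>k<N. l k) + card J * p = N * V"
  proof -
    have "card J * p = (\<Sum>k<N. if k \<in> J then p else 0)"
      using J by (simp add: sum.If_cases Int_absorb1)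
    then have "(\<Sum>k<N. l k) + card J * p = (\<Sum>k<N. l k + (if k \<in> J then p else 0))"
      by (simp add: sum.distrib)
    also have "\<dots> = (\<Sum>k<N. V)" using p by (intro sum.cong) (simp_all add: l_def)
    finally show ?thesis by simp
  qed
  moreover have "(\<Sum>k<N. E k) + repeat_mset (card J) D = (\<Sum>i<N * V. B i)"
  proof -
    have "repeat_mset (card J) D = (\<Sum>k<N. if k \<in> J then D else {#})"
      using J finJ by (simp add: sum.If_cases Int_absorb1 sum_const_mset)
    then have "(\<Sum>k<N. E k) + repeat_mset (card J) D = (\<Sum>k<N. E k + (if k \<in> J then D else {#}))"
      by (simp add: sum.distrib)
    also have "\<dots> = (\<Sum>k<N. \<Sum>i=k * V..<k * V + V. B i)"
    proof (rule sum.cong[OF refl])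
      fix k
      show "E k + (if k \<in> J then D else {#}) = (\<Sum>i=k * V..<k * V + V. B i)"
      proof (cases "k \<in> J")
        case True
        note w = win[OF True]
        have "(\<Sum>i=k * V..<k * V + V. B i) = (\<Sum>i=k * V..<x k. B i) + (\<Sum>i=x k..<k * V + V. B i)"
          using w by (intro sum.atLeastLessThan_concat[symmetric]) simp_all
        also have "(\<Sum>i=x k..<k * V + V. B i) = (\<Sum>i=x k..<x k + p. B i) + (\<Sum>i=x k + p..<k * V + V. B i)"
          using w by (intro sum.atLeastLessThan_concat[symmetric]) simp_all
        finally show ?thesis using w True by (simp add: E_def add.commute add.left_commute)
      qed (simp add: E_def add.commute)
    qed
    also have "\<dots> = (\<Sum>i<N * V. B i)" by (rule sum.nat_group)
    finally show ?thesis .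
  qed
  ultimately show ?thesis by blast
qed

lemma tileable_grid_split:
  assumes X: "finite X"
  shows "\<exists>b. \<forall>m A. b < m \<and> tileable (grid n m) A \<and> set_mset A \<subseteq> X \<longrightarrow>
    (\<exists>m' m'' A' A''. m = m' + m'' \<and> m' \<noteq> 0 \<and> m'' \<noteq> 0 \<and> A = A' + A'' \<and>
       tileable (grid n m') A' \<and> tileable (grid n m'') A'')"
proof -
  \<comment> \<open>The inserted 0 covers the case of empty \<open>X\<close>.\<close>
  define W where "W = Max (insert 0 (fst ` X))"
  have W: "w \<le> W" if "(w, h) \<in> X" for w h
    unfolding W_def using X that by (intro Max_ge) force+
  \<comment> \<open>A common multiple of all widths from 1 to \<open>W\<close>.\<close>
  define M :: nat where "M = fact W"
  have M: "0 < M" by (simp add: M_def)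
  define V where "V = card (profiles n W)"
  have finprof: "finite (profiles n W)" by (intro finite_PiE) simp_all
  have "(\<lambda>j\<in>{0..<int n}. 0) \<in> profiles n W" by auto
  then have V: "0 < V" unfolding V_def using finprof card_gt_0_iff by blast
  \<comment> \<open>The possible pairs of a period and the multiset of a block. A period is at most
    \<open>V\<close>, so a block has at most \<open>n * V\<close> cells and no more pieces than
    that.\<close>
  define F where "F = {1..V} \<times> (\<Union>s\<le>n * V. multisets_of_size X s)"
  have finF: "finite F" unfolding F_def using X finite_multisets_of_size by auto
  have "(1, {#}) \<in> F" using V by (auto simp: F_def multisets_of_size_def)
  then have cardF: "0 < card F" using finF card_gt_0_iff by blast
  \<comment> \<open>Enough windows for \<open>M\<close> of them to agree in period and
    multiset.\<close>
  define N where "N = M * card F"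
  have MN: "M \<le> N" using cardF by (simp add: N_def)
  show ?thesis
  proof (rule exI[of _ "N * V"], intro allI impI, elim conjE)
    fix m A assume m: "N * V < m" and tile: "tileable (grid n m) A" and AX: "set_mset A \<subseteq> X"
    have widths: "w \<le> W" if "(w, h) \<in># A" for w h using W AX that by blast
    obtain t B where tB: "\<forall>k\<le>m. t k \<in> profiles n W"
      "\<forall>j\<in>{0..<int n}. t 0 j = 0" "\<forall>j\<in>{0..<int n}. t m j = 0"
      "\<forall>k<m. ragged n (t k) (t (Suc k)) 1 (B k)" and A: "A = (\<Sum>k<m. B k)"
      by (rule tileable_grid_walk[OF tile widths])
    note prof = tB(1)[rule_format] and t0 = tB(2)[rule_format] and tm = tB(3)[rule_format]
      and walk = tB(4)[rule_format]
    have BX: "set_mset (\<Sum>i=a..<b. B i) \<subseteq> X" if "b \<le> m" for a b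
    proof -
      have "A = (\<Sum>i\<in>{..<m} - {a..<b}. B i) + (\<Sum>i=a..<b. B i)"
        unfolding A using that by (intro sum.subset_diff) auto
      then show ?thesis using AX by simp
    qed
    have "\<exists>x y. k * V \<le> x \<and> x < y \<and> y \<le> k * V + V \<and> t x = t y" if "k < N" for k
    proof (rule repeated_value_in_window[OF finprof])
      have "k * V + V \<le> N * V" using mult_le_mono1[of "Suc k" N V] that by simp
      then show "t i \<in> profiles n W" if "i \<in> {k * V..k * V + V}" for i
        using that m by (intro prof) simp
    qed (simp add: V_def)
    then obtain x y where xy: "\<And>k. k < N \<Longrightarrow> k * V \<le> x k \<and> x k < y k \<and> y k \<le> k * V + V \<and> t (x k) = t (y k)"
      by metis
    define f where "f k = (y k - x k, \<Sum>i=x k..<y k. B i)" for k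
    have ym: "y k \<le> N * V" if "k < N" for k
      using mult_le_mono1[of "Suc k" N V] xy[OF that] that by simp
    have "f \<in> {..<N} \<rightarrow> F"
    proof
      fix k assume "k \<in> {..<N}"
      then have k: "k < N" by simp
      note * = xy[OF k]
      have "ragged n (t (x k)) (t (y k)) (y k - x k) (\<Sum>i=x k..<y k. B i)"
        using * ym[OF k] m by (intro ragged_walk[where B=B and m=m] walk) simp_all
      then have "ragged n (t (x k)) (t (x k)) (y k - x k) (\<Sum>i=x k..<y k. B i)" using * by simp
      then have "size (\<Sum>i=x k..<y k. B i) \<le> n * (y k - x k)"
        unfolding ragged_def using tileable_size_le_card card_ragged_le le_trans by blast
      also have "\<dots> \<le> n * V" using * by (intro mult_le_mono2) linarith
      finally show "f k \<in> F"
        using * BX[of "y k" "x k"] ym[OF k] m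
        by (simp add: f_def F_def multisets_of_size_def Suc_le_eq) linarith
    qed
    moreover have "F \<noteq> {}" using cardF by auto
    ultimately have "\<exists>c\<in>F. card {..<N} \<le> card (f -` {c} \<inter> {..<N}) * card F"
      using finF by (intro pigeonhole_card) simp_all
    then obtain c where c: "c \<in> F" "card {..<N} \<le> card (f -` {c} \<inter> {..<N}) * card F" ..
    have "M \<le> card (f -` {c} \<inter> {..<N})" using c(2) cardF by (simp add: N_def)
    then obtain J where J: "J \<subseteq> f -` {c} \<inter> {..<N}" "card J = M"
      by (meson obtain_subset_with_card_n)
    obtain p D where pD: "c = (p, D)" by (cases c)
    have win: "y k = x k + p" "(\<Sum>i=x k..<x k + p. B i) = D" "k < N" if "k \<in> J" for k
    proof -
      show k: "k < N" using J(1) that by auto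
      have "f k = (p, D)" using J(1) that pD by auto
      then have *: "y k - x k = p" "(\<Sum>i=x k..<y k. B i) = D" by (simp_all add: f_def)
      then show y: "y k = x k + p" using xy[OF k] by linarith
      show "(\<Sum>i=x k..<x k + p. B i) = D" using *(2) unfolding y .
    qed
    \<comment> \<open>The chosen windows agree in period and multiset, so any one of them supplies
      the block to be unrolled.\<close>
    have "J \<noteq> {}" using J(2) M by auto
    then obtain k0 where k0: "k0 \<in> J" by blast
    have p: "0 < p" "p \<le> V" using c(1) by (auto simp: pD F_def)
    have "\<exists>l E. ragged n (t 0) (t (N * V)) l E \<and> l + card J * p = N * V \<and>
      E + repeat_mset (card J) D = (\<Sum>i<N * V. B i)"
    proof (rule remove_windows)
      show "ragged n (t k) (t (Suc k)) 1 (B k)" if "k < N * V" for k using walk that m by simp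
      show "J \<subseteq> {..<N}" using J(1) by blast
      show "k * V \<le> x k \<and> x k + p \<le> Suc k * V \<and> t (x k) = t (x k + p) \<and>
        (\<Sum>i=x k..<x k + p. B i) = D" if "k \<in> J" for k
        using xy[OF win(3)[OF that]] win(1,2)[OF that] by simp
    qed
    then obtain l E where l: "ragged n (t 0) (t (N * V)) l E" "l + M * p = N * V"
      "E + repeat_mset M D = (\<Sum>i<N * V. B i)" using J(2) by auto
    have "ragged n (t (N * V)) (t m) (m - N * V) (\<Sum>i=N * V..<m. B i)"
      using m by (intro ragged_walk[where B=B and m=m] walk) simp_all
    \<comment> \<open>The profiles at both ends vanish on all rows, so the shortened walk again
      describes a rectangle.\<close>
    from ragged_append[OF l(1) this]
    have rest: "tileable (grid n (l + (m - N * V))) (E + (\<Sum>i=N * V..<m. B i))"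
      using tileable_grid_iff_ragged[OF t0 tm] by simp
    have "ragged n (t (x k0)) (t (y k0)) (y k0 - x k0) (\<Sum>i=x k0..<y k0. B i)"
      using xy[OF win(3)[OF k0]] ym[OF win(3)[OF k0]] m by (intro ragged_walk[where B=B and m=m] walk) simp_all
    then have cyc: "ragged n (t (x k0)) (t (x k0)) p D"
      using win(1,2)[OF k0] xy[OF win(3)[OF k0]] by simp
    have "w dvd M" if wh: "(w, h) \<in># D" for w h
    proof -
      have "(w, h) \<in> X"
        using BX[of "y k0" "x k0"] ym[OF win(3)[OF k0]] m win(1,2)[OF k0] wh by auto
      then have "w \<le> W" by (rule W)
      moreover have "0 < w" using tileable_sizes_pos[OF _ wh] cyc unfolding ragged_def by blast
      ultimately show "w dvd M" unfolding M_def by (intro dvd_fact) simp_all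
    qed
    then have block: "tileable (grid n (M * p)) (repeat_mset M D)"
      by (rule cyclic_block_tileable[OF cyc p(1) M])
    have "A = (\<Sum>i<N * V. B i) + (\<Sum>i=N * V..<m. B i)"
      unfolding A using m sum.atLeastLessThan_concat[of 0 "N * V" m B] by (simp add: atLeast0LessThan)
    then have "A = repeat_mset M D + (E + (\<Sum>i=N * V..<m. B i))"
      using l(3) by (simp add: ac_simps)
    moreover have "m = M * p + (l + (m - N * V))" using l(2) m by simp
    \<comment> \<open>The columns beyond the last window keep the second rectangle nonempty even
      when \<open>l = 0\<close>; this is where \<open>N * V < m\<close> enters strictly.\<close>
    moreover have "M * p \<noteq> 0" "l + (m - N * V) \<noteq> 0" using M p m by simp_all
    ultimately show "\<exists>m' m'' A' A''. m = m' + m'' \<and> m' \<noteq> 0 \<and> m'' \<noteq> 0 \<and> A = A' + A'' \<and>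
       tileable (grid n m') A' \<and> tileable (grid n m'') A''"
      using block rest by blast
  qed
qed

section \<open>Tilings of the real rectangle\<close>

definition region_of :: "placed \<Rightarrow> region" where
  "region_of q = {of_int (left q)..of_int (left q) + real (width q)} \<times>
                 {of_int (bottom q)..of_int (bottom q) + real (height q)}"

lemma translate_box:
  fixes v :: "real \<times> real"
  shows "(+) v ` ({a..b} \<times> {c..d}) = {fst v + a..fst v + b} \<times> {snd v + c..snd v + d}"
proof (rule set_eqI)
  fix p
  show "p \<in> (+) v ` ({a..b} \<times> {c..d}) \<longleftrightarrow> p \<in> {fst v + a..fst v + b} \<times> {snd v + c..snd v + d}"
  proof
    assume "p \<in> {fst v + a..fst v + b} \<times> {snd v + c..snd v + d}"
    then have "p - v \<in> {a..b} \<times> {c..d}" by (auto simp: mem_Times_iff)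
    moreover have "p = v + (p - v)" by simp
    ultimately show "p \<in> (+) v ` ({a..b} \<times> {c..d})" by (rule image_eqI[rotated])
  qed (auto simp: mem_Times_iff)
qed

lemma translation_class_translate: "translation_class ((+) v ` X) = translation_class X"
proof -
  have "range (\<lambda>u. (+) (u + v) ` X) = (\<lambda>u. (+) u ` X) ` range (\<lambda>u. u + v)"
    by (simp only: image_image)
  also have "range (\<lambda>u. u + v) = UNIV"
    by (rule surjI[of _ "\<lambda>u. u - v"]) simp
  finally show ?thesis by (simp add: translation_class_def image_image add.assoc)
qed

lemma self_in_translation_class: "X \<in> translation_class X"
  unfolding translation_class_def by (rule range_eqI[of _ _ 0]) simp

lemma translation_class_region_of: "translation_class (region_of q) = rect_polyomino (height q) (width q)"
proof -
  have "region_of q = (+) (of_int (left q), of_int (bottom q)) ` rectangle (height q) (width q)"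
    by (simp add: region_of_def rectangle_def translate_box)
  then show ?thesis by (simp add: translation_class_translate rect_polyomino_def)
qed

lemma region_of_shift: "region_of (shift (int d) q) = (+) (real d, 0) ` region_of q"
  unfolding region_of_def translate_box by (simp add: algebra_simps)

lemma rect_polyomino_member:
  assumes "translation_class X = rect_polyomino h w"
  shows "\<exists>x y. X = {x..x + real w} \<times> {y..y + real h}"
proof -
  have "X \<in> translation_class (rectangle h w)"
    using assms self_in_translation_class unfolding rect_polyomino_def by metis
  then obtain v where "X = (+) v ` rectangle h w" by (auto simp: translation_class_def)
  then show ?thesis unfolding rectangle_def translate_box
    by (intro exI[of _ "fst v"] exI[of _ "snd v"]) simp
qed

lemma interior_box_Int:
  fixes a b c d :: real
  shows "interior (({a..b} \<times> {c..d}) \<inter> ({a'..b'} \<times> {c'..d'})) =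
    {max a a'<..<min b b'} \<times> {max c c'<..<min d d'}"
  by (simp add: Times_Int_Times interior_Times interior_atLeastAtMost_real)

text \<open>A half-open interval of integral length \<open>w\<close> contains exactly
  \<open>w\<close> integers, wherever it starts. Rounding up therefore preserves the dimensions of a
  piece.\<close>

lemma half_open_mem_iff: "real_of_int i \<in> {x..<x + real w} \<longleftrightarrow> i \<in> {\<lceil>x\<rceil>..<\<lceil>x\<rceil> + int w}"
proof -
  have "real_of_int i < x + real w \<longleftrightarrow> \<not> x \<le> real_of_int (i - int w)" by auto
  also have "\<dots> \<longleftrightarrow> \<not> \<lceil>x\<rceil> \<le> i - int w" by (simp only: ceiling_le_iff)
  finally show ?thesis by (simp add: ceiling_le_iff) linarith
qed

text \<open>Rounding the corners of the pieces up keeps exactly the lattice points of the half-open pieces,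
  so a tiling need not be shown to have integral corners.\<close>

lemma tiling_imp_tileable:
  assumes D: "tiling n m D"
    and dims: "\<And>X. X \<in> D \<Longrightarrow> 0 < w X \<and> 0 < h X \<and> translation_class X = rect_polyomino (h X) (w X)"
  shows "tileable (grid n m) (image_mset (\<lambda>X. (w X, h X)) (mset_set D))"
proof -
  have fin: "finite D" and un: "\<Union> D = rectangle n m"
    and disj: "\<And>X Y. X \<in> D \<Longrightarrow> Y \<in> D \<Longrightarrow> X \<noteq> Y \<Longrightarrow> interior (X \<inter> Y) = {}"
    using D unfolding tiling_def by blast+
  have "\<exists>x y. X = {x..x + real (w X)} \<times> {y..y + real (h X)}" if "X \<in> D" for X
    using rect_polyomino_member dims[OF that] by blast
  then obtain x y where box: "\<And>X. X \<in> D \<Longrightarrow> X = {x X..x X + real (w X)} \<times> {y X..y X + real (h X)}"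
    by metis
  define f where "f X = Placed \<lceil>x X\<rceil> \<lceil>y X\<rceil> (w X) (h X)" for X
  have cell_f: "(i, j) \<in> cells (f X) \<longleftrightarrow>
      real_of_int i \<in> {x X..<x X + real (w X)} \<and> real_of_int j \<in> {y X..<y X + real (h X)}" for i j X
    unfolding half_open_mem_iff by (simp add: cells_def f_def)
  \<comment> \<open>A lattice point common to two half-open boxes leaves room to its upper right in
    both, so their interiors would overlap.\<close>
  have meet: "X = Y" if X: "X \<in> D" and Y: "Y \<in> D" and c: "c \<in> cells (f X)" "c \<in> cells (f Y)" for X Y c
  proof (rule ccontr)
    assume "X \<noteq> Y"
    obtain i j where ij: "c = (i, j)" by (cases c)
    have "interior (({x X..x X + real (w X)} \<times> {y X..y X + real (h X)}) \<inter>
        ({x Y..x Y + real (w Y)} \<times> {y Y..y Y + real (h Y)})) = {}"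
      using disj[OF X Y \<open>X \<noteq> Y\<close>] box[OF X] box[OF Y] by simp
    moreover have "max (x X) (x Y) < min (x X + real (w X)) (x Y + real (w Y))"
      "max (y X) (y Y) < min (y X + real (h X)) (y Y + real (h Y))"
      using c unfolding ij cell_f by auto
    ultimately show False unfolding interior_box_Int by simp
  qed
  have inj: "inj_on f D"
  proof (rule inj_onI)
    fix X Y assume X: "X \<in> D" and Y: "Y \<in> D" and eq: "f X = f Y"
    have "cells (f X) \<noteq> {}" using dims[OF X] by (intro cells_nonempty) (simp_all add: f_def)
    then show "X = Y" using meet[OF X Y] eq by auto
  qed
  have sub: "cells (f X) \<subseteq> grid n m" if X: "X \<in> D" for X
  proof (rule subsetI)
    fix c assume c: "c \<in> cells (f X)"
    obtain i j where ij: "c = (i, j)" by (cases c)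
    have XR: "{x X..x X + real (w X)} \<times> {y X..y X + real (h X)} \<subseteq> {0..real m} \<times> {0..real n}"
      using un X box[OF X] unfolding rectangle_def by blast
    have "(x X, y X) \<in> {0..real m} \<times> {0..real n}"
      "(x X + real (w X), y X + real (h X)) \<in> {0..real m} \<times> {0..real n}"
      by (rule subsetD[OF XR], simp)+
    then have "0 \<le> real_of_int i \<and> real_of_int i < real m" "0 \<le> real_of_int j \<and> real_of_int j < real n"
      using c unfolding ij cell_f by auto
    then show "c \<in> grid n m" unfolding ij grid_def by auto
  qed
  \<comment> \<open>Approach the lattice point diagonally from the upper right. As \<open>D\<close>
    is finite, one closed piece contains such points arbitrarily close to it, and the half-open
    version of that piece contains the lattice point.\<close>
  have cover: "\<exists>X\<in>D. c \<in> cells (f X)" if c: "c \<in> grid n m" for c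
  proof -
    obtain i j where ij: "c = (i, j)" by (cases c)
    have b: "0 \<le> i" "i + 1 \<le> int m" "0 \<le> j" "j + 1 \<le> int n" using c unfolding ij grid_def by auto
    have b': "real_of_int i + 1 \<le> real m" "real_of_int j + 1 \<le> real n" using b by linarith+
    have "\<forall>\<^sub>F e in at_right 0. \<exists>X\<in>D. (real_of_int i + e, real_of_int j + e) \<in> X"
    proof -
      have "\<forall>\<^sub>F e :: real in at_right 0. e \<in> {0<..<1}" by (rule eventually_at_right_real) simp
      then show ?thesis
      proof (rule eventually_mono)
        fix e :: real assume "e \<in> {0<..<1}"
        then have "(real_of_int i + e, real_of_int j + e) \<in> \<Union> D"
          using b b' unfolding un rectangle_def by simp
        then show "\<exists>X\<in>D. (real_of_int i + e, real_of_int j + e) \<in> X" by blast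
      qed
    qed
    then have "\<exists>\<^sub>F e in at_right 0. \<exists>X\<in>D. (real_of_int i + e, real_of_int j + e) \<in> X"
      by (rule eventually_frequently[rotated]) simp
    from frequently_bex_finite[OF fin this]
    obtain X where X: "X \<in> D" and freq: "\<exists>\<^sub>F e in at_right 0. (real_of_int i + e, real_of_int j + e) \<in> X"
      by blast
    have ex: "\<exists>e>0. e < d \<and> (real_of_int i + e, real_of_int j + e) \<in> X" if "0 < d" for d :: real
    proof -
      have "\<forall>\<^sub>F e in at_right 0. e \<in> {0<..<d}" using that by (rule eventually_at_right_real)
      then have "\<exists>\<^sub>F e in at_right 0. (real_of_int i + e, real_of_int j + e) \<in> X \<and> e \<in> {0<..<d}"
        by (rule frequently_eventually_frequently[OF freq])
      then show ?thesis using frequently_ex by fastforce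
    qed
    have memX: "x X \<le> real_of_int i + e \<and> real_of_int i + e \<le> x X + real (w X) \<and>
      y X \<le> real_of_int j + e \<and> real_of_int j + e \<le> y X + real (h X)"
      if "(real_of_int i + e, real_of_int j + e) \<in> X" for e
      using that box[OF X] by (metis atLeastAtMost_iff mem_Sigma_iff)
    have "x X \<le> real_of_int i"
    proof (rule ccontr)
      assume "\<not> x X \<le> real_of_int i"
      then show False using ex[of "x X - real_of_int i"] memX by force
    qed
    moreover have "y X \<le> real_of_int j"
    proof (rule ccontr)
      assume "\<not> y X \<le> real_of_int j"
      then show False using ex[of "y X - real_of_int j"] memX by force
    qed
    \<comment> \<open>A single positive \<open>e\<close> makes the upper inequalities strict at the
      lattice point itself.\<close>
    moreover obtain e where "e > 0" "(real_of_int i + e, real_of_int j + e) \<in> X" using ex[of 1] by auto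
    ultimately have "c \<in> cells (f X)" using memX[of e] unfolding ij cell_f by simp
    then show ?thesis using X by blast
  qed
  have "packing (f ` D) (grid n m)"
    unfolding packing_def
  proof (intro conjI)
    show "finite (f ` D)" using fin by simp
    show "\<forall>q\<in>f ` D. 0 < width q \<and> 0 < height q" using dims by (simp add: f_def)
    show "disjoint_family_on cells (f ` D)"
      unfolding disjoint_family_on_def
    proof (intro ballI impI)
      fix q r assume "q \<in> f ` D" "r \<in> f ` D" "q \<noteq> r"
      then obtain X Y where "q = f X" "r = f Y" "X \<in> D" "Y \<in> D" "X \<noteq> Y" by blast
      then show "cells q \<inter> cells r = {}" using meet by blast
    qed
    show "(\<Union>q\<in>f ` D. cells q) = grid n m" using sub cover by blast
  qed
  moreover have "sizes (f ` D) = image_mset (\<lambda>X. (w X, h X)) (mset_set D)"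
    unfolding sizes_def image_mset_mset_set[OF inj, symmetric]
    by (simp add: image_mset.compositionality comp_def f_def)
  ultimately show ?thesis by (rule tileableI)
qed

lemma packing_imp_tiling:
  assumes P: "packing P (grid n m)" and nm: "0 < n" "0 < m"
    and poly: "\<And>q. q \<in> P \<Longrightarrow> polyomino (rect_polyomino (height q) (width q))"
  shows "tiling n m (region_of ` P)"
    and "pieces (region_of ` P) = image_mset (\<lambda>(w, h). rect_polyomino h w) (sizes P)"
proof -
  have fin: "finite P" and pos: "\<And>q. q \<in> P \<Longrightarrow> 0 < width q \<and> 0 < height q"
    and un: "(\<Union>q\<in>P. cells q) = grid n m"
    using P unfolding packing_def by blast+
  have meet: "q = r" if q: "q \<in> P" and r: "r \<in> P" and ne: "interior (region_of q \<inter> region_of r) \<noteq> {}" for q r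
  proof -
    have "max (real_of_int (left q)) (of_int (left r)) < min (of_int (left q) + real (width q)) (of_int (left r) + real (width r))"
      "max (real_of_int (bottom q)) (of_int (bottom r)) < min (of_int (bottom q) + real (height q)) (of_int (bottom r) + real (height r))"
      using ne unfolding region_of_def interior_box_Int by auto
    \<comment> \<open>The lower left cell of the overlap belongs to both pieces.\<close>
    then have "(max (left q) (left r), max (bottom q) (bottom r)) \<in> cells q"
      "(max (left q) (left r), max (bottom q) (bottom r)) \<in> cells r"
      unfolding cells_def by auto
    then show ?thesis using packing_cells_unique[OF P q r] by blast
  qed
  \<comment> \<open>Each region overlaps itself, so pieces with equal regions are equal by
    \<open>meet\<close>.\<close>
  have "interior (region_of q \<inter> region_of q) \<noteq> {}" if "q \<in> P" for q
    using pos[OF that] unfolding region_of_def interior_box_Int by simp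
  then have inj: "inj_on region_of P"
    by (intro inj_onI) (use meet in metis)
  have "(\<Union>q\<in>P. region_of q) = rectangle n m"
  proof (rule equalityI; rule subsetI)
    fix c assume "c \<in> (\<Union>q\<in>P. region_of q)"
    then obtain q where q: "q \<in> P" "c \<in> region_of q" by blast
    have "(left q, bottom q) \<in> cells q" "(left q + int (width q) - 1, bottom q + int (height q) - 1) \<in> cells q"
      using pos[OF q(1)] by (simp_all add: cells_def)
    then have "(left q, bottom q) \<in> grid n m" "(left q + int (width q) - 1, bottom q + int (height q) - 1) \<in> grid n m"
      using packing_cells_subset[OF P q(1)] by blast+
    then have "0 \<le> left q" "left q + int (width q) \<le> int m" "0 \<le> bottom q" "bottom q + int (height q) \<le> int n"
      by (simp_all add: grid_def)
    then have "0 \<le> real_of_int (left q)" "of_int (left q) + real (width q) \<le> real m"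
      "0 \<le> real_of_int (bottom q)" "of_int (bottom q) + real (height q) \<le> real n" by linarith+
    then show "c \<in> rectangle n m"
      using q(2) unfolding region_of_def rectangle_def by (auto simp: mem_Times_iff)
  next
    fix c assume c: "c \<in> rectangle n m"
    \<comment> \<open>The minimum assigns points on the right and top edges of the closed rectangle
      to the last column and row.\<close>
    define i where "i = min \<lfloor>fst c\<rfloor> (int m - 1)"
    define j where "j = min \<lfloor>snd c\<rfloor> (int n - 1)"
    have c': "0 \<le> fst c" "fst c \<le> real m" "0 \<le> snd c" "snd c \<le> real n"
      using c unfolding rectangle_def by (auto simp: mem_Times_iff)
    have ci: "real_of_int i \<le> fst c" "fst c \<le> real_of_int i + 1"
      and cj: "real_of_int j \<le> snd c" "snd c \<le> real_of_int j + 1"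
      using c' unfolding i_def j_def min_def by (auto split: if_splits) linarith+
    have "(i, j) \<in> grid n m" using c' nm unfolding grid_def i_def j_def by auto
    then have "(i, j) \<in> (\<Union>q\<in>P. cells q)" unfolding un .
    then obtain q where q: "q \<in> P" "(i, j) \<in> cells q" by blast
    then have "left q \<le> i" "i + 1 \<le> left q + int (width q)" "bottom q \<le> j" "j + 1 \<le> bottom q + int (height q)"
      by (simp_all add: cells_def)
    then have "real_of_int (left q) \<le> of_int i" "real_of_int i + 1 \<le> of_int (left q) + real (width q)"
      "real_of_int (bottom q) \<le> of_int j" "real_of_int j + 1 \<le> of_int (bottom q) + real (height q)" by linarith+
    then have "c \<in> region_of q" using ci cj unfolding region_of_def mem_Times_iff by simp
    then show "c \<in> (\<Union>q\<in>P. region_of q)" using q(1) by blast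
  qed
  moreover have "interior (X \<inter> Y) = {}" if "X \<in> region_of ` P" "Y \<in> region_of ` P" "X \<noteq> Y" for X Y
    using that meet by blast
  ultimately show "tiling n m (region_of ` P)"
    unfolding tiling_def using fin poly by (simp add: translation_class_region_of)
  show "pieces (region_of ` P) = image_mset (\<lambda>(w, h). rect_polyomino h w) (sizes P)"
    unfolding pieces_def sizes_def image_mset_mset_set[OF inj, symmetric]
    by (simp add: image_mset.compositionality comp_def translation_class_region_of)
qed

section \<open>Juxtaposition of tilings and the Noetherian property\<close>

lemma grid_juxtapose: "grid n m' \<union> {(i, j). (i - int m', j) \<in> grid n m''} = grid n (m' + m'')"
  by (auto simp: grid_def)

lemma splits_of_tileable:
  assumes A': "tileable (grid n m') A'" and A'': "tileable (grid n m'') A''"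
    and pos: "0 < n" "m' \<noteq> 0" "m'' \<noteq> 0"
    and poly: "\<And>w h. (w, h) \<in># A' + A'' \<Longrightarrow> polyomino (rect_polyomino h w)"
  shows "\<exists>D. tiling_by n (m' + m'') (image_mset (\<lambda>(w, h). rect_polyomino h w) (A' + A'')) D \<and>
    splits n (m' + m'') D"
proof -
  from A' obtain P where P: "packing P (grid n m')" "sizes P = A'" by (rule tileableE)
  from A'' obtain Q where Q: "packing Q (grid n m'')" "sizes Q = A''" by (rule tileableE)
  let ?Q = "shift (int m') ` Q"
  have disj: "grid n m' \<inter> {(i, j). (i - int m', j) \<in> grid n m''} = {}" by (auto simp: grid_def)
  have PQ: "packing (P \<union> ?Q) (grid n (m' + m''))"
    using packing_Un(1)[OF P(1) packing_shift[OF Q(1)] disj] by (simp only: grid_juxtapose)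
  have fin: "finite P" "finite Q" using P(1) Q(1) by (simp_all add: packing_def)
  have sizesPQ: "sizes (P \<union> ?Q) = A' + A''"
    using sizes_Un[OF fin(1) finite_imageI[OF fin(2)] packing_Un(2)[OF P(1) packing_shift[OF Q(1)] disj]]
    by (simp add: sizes_shift P(2) Q(2))
  have polyP: "polyomino (rect_polyomino (height q) (width q))" if "q \<in> P" for q
    using poly[of "width q" "height q"] that fin P(2) by (auto simp: sizes_def)
  have polyQ: "polyomino (rect_polyomino (height q) (width q))" if "q \<in> Q" for q
    using poly[of "width q" "height q"] that fin Q(2) by (auto simp: sizes_def)
  have polyPQ: "polyomino (rect_polyomino (height q) (width q))" if "q \<in> P \<union> ?Q" for q
    using that polyP polyQ by auto
  have "region_of ` (P \<union> ?Q) = juxtapose m' (region_of ` P) (region_of ` Q)"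
    by (simp add: juxtapose_def image_Un image_image region_of_shift)
  then have "splits n (m' + m'') (region_of ` (P \<union> ?Q))"
    unfolding splits_def
    using packing_imp_tiling(1)[OF P(1) pos(1) _ polyP] packing_imp_tiling(1)[OF Q(1) pos(1) _ polyQ] pos
    by blast
  moreover have "tiling_by n (m' + m'') (image_mset (\<lambda>(w, h). rect_polyomino h w) (A' + A'')) (region_of ` (P \<union> ?Q))"
    unfolding tiling_by_def using packing_imp_tiling[OF PQ pos(1) _ polyPQ] pos by (simp add: sizesPQ)
  ultimately show ?thesis by blast
qed

text \<open>For \<open>n = 0\<close> the strip is a nonempty segment or point, and no piece of
  positive height fits into it; the subtiling condition then holds vacuously.\<close>

lemma no_tiling_of_height_zero:
  assumes D: "tiling 0 m D" and rect: "\<forall>X\<in>D. rectangular (translation_class X)"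
  shows False
proof -
  have un: "\<Union> D = {0..real m} \<times> {0}" using D by (simp add: tiling_def rectangle_def)
  have "(0, 0) \<in> \<Union> D" unfolding un by simp
  then obtain X where X: "X \<in> D" by blast
  then obtain h w where hw: "1 \<le> h" "translation_class X = rect_polyomino h w"
    using rect unfolding rectangular_def by blast
  then obtain x y where "X = {x..x + real w} \<times> {y..y + real h}"
    using rect_polyomino_member by blast
  then have "(x, y) \<in> X" "(x, y + real h) \<in> X" by simp_all
  then have "y = 0" "y + real h = 0" using X un by blast+
  then show False using hw(1) by simp
qed

theorem strongly_noetherian_rectangular:
  assumes L: "finite L" "\<forall>P\<in>L. rectangular P"
  shows "strongly_noetherian n L"
proof -
  \<comment> \<open>One pair of dimensions is fixed for each element of \<open>L\<close>, so only
    finitely many sizes occur.\<close>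
  define d where "d P = (SOME d. 0 < fst d \<and> 0 < snd d \<and> P = rect_polyomino (snd d) (fst d))" for P
  have d: "0 < fst (d P) \<and> 0 < snd (d P) \<and> P = rect_polyomino (snd (d P)) (fst (d P))" if "P \<in> L" for P
  proof -
    have "rectangular P" using L(2) that by (rule bspec)
    then obtain h w where "1 \<le> h" "1 \<le> w" "P = rect_polyomino h w"
      unfolding rectangular_def by (elim exE conjE)
    then have "0 < fst (w, h) \<and> 0 < snd (w, h) \<and> P = rect_polyomino (snd (w, h)) (fst (w, h))" by simp
    then show ?thesis unfolding d_def by (rule someI)
  qed
  obtain b where b: "\<forall>m A. b < m \<and> tileable (grid n m) A \<and> set_mset A \<subseteq> d ` L \<longrightarrow>
    (\<exists>m' m'' A' A''. m = m' + m'' \<and> m' \<noteq> 0 \<and> m'' \<noteq> 0 \<and> A = A' + A'' \<and>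
       tileable (grid n m') A' \<and> tileable (grid n m'') A'')"
    using tileable_grid_split[of "d ` L" n] L(1) by blast
  have "subtiling_bound n L b"
    unfolding subtiling_bound_def
  proof (intro allI impI, elim conjE)
    fix m D assume m: "b < m" and "tiling_from n m L D"
    then have D: "tiling n m D" and DL: "set_mset (pieces D) \<subseteq> L"
      by (auto simp: tiling_from_def tiling_by_def)
    have fin: "finite D" using D by (simp add: tiling_def)
    have inL: "translation_class X \<in> L" if "X \<in> D" for X
      using DL that fin by (auto simp: pieces_def)
    have n: "0 < n"
    proof (rule ccontr)
      assume "\<not> 0 < n"
      then show False using no_tiling_of_height_zero[of m D] D inL L(2) by simp
    qed
    let ?d = "\<lambda>X. d (translation_class X)"
    define A where "A = image_mset ?d (mset_set D)"
    have dX: "0 < fst (?d X)" "0 < snd (?d X)" "translation_class X = rect_polyomino (snd (?d X)) (fst (?d X))"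
      if "X \<in> D" for X using d[OF inL[OF that]] by blast+
    have "tileable (grid n m) A"
      using tiling_imp_tileable[OF D, of "\<lambda>X. fst (?d X)" "\<lambda>X. snd (?d X)"] dX by (simp add: A_def)
    moreover have "set_mset A \<subseteq> d ` L" using inL fin by (auto simp: A_def)
    ultimately obtain m' m'' A' A'' where split: "m = m' + m''" "m' \<noteq> 0" "m'' \<noteq> 0" "A = A' + A''"
      "tileable (grid n m') A'" "tileable (grid n m'') A''" using b m by blast
    \<comment> \<open>Reading sizes back as polyominoes recovers \<open>pieces D\<close>, so a
      tiling with sizes \<open>A\<close> is a rearrangement of \<open>D\<close>.\<close>
    have pcs: "image_mset (\<lambda>(w, h). rect_polyomino h w) A = pieces D"
      unfolding A_def pieces_def image_mset.compositionality comp_def case_prod_unfold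
      using dX(3) fin by (intro image_mset_cong) simp
    \<comment> \<open>Every size in the new tilings occurs in \<open>D\<close>, whose pieces are
      polyominoes because \<open>D\<close> is a tiling.\<close>
    have "polyomino (rect_polyomino h w)" if wh: "(w, h) \<in># A' + A''" for w h
    proof -
      obtain X where "X \<in> D" "(w, h) = ?d X"
        using wh fin unfolding split(4)[symmetric] A_def by auto
      then show ?thesis using D dX(3)[of X] unfolding tiling_def by (metis fst_conv snd_conv)
    qed
    from splits_of_tileable[OF split(5,6) n split(2,3) this]
    show "admits_subtiling n m D"
      unfolding admits_subtiling_def rearrangement_def split(1) pcs[symmetric] split(4) by blast
  qed
  then show ?thesis unfolding strongly_noetherian_def beta_def by auto
qed

text \<open>With zero quarter turns for every piece, a rearrangement is also a rearrangement with
  rotations, so the same bound serves.\<close>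

lemma strongly_noetherian_imp_noetherian:
  assumes "strongly_noetherian n L"
  shows "noetherian n L"
proof -
  have "rotated_copy P P" for P
    unfolding rotated_copy_def by (rule exI[of _ 0]) simp
  then have refl: "rel_mset rotated_copy T T" for T
    by (rule multiset.rel_refl)
  from assms obtain b where "subtiling_bound n L b"
    unfolding strongly_noetherian_def beta_def by (auto split: if_splits)
  then have "subtiling_bound_rot n L b"
    unfolding subtiling_bound_def subtiling_bound_rot_def admits_subtiling_def admits_subtiling_rot_def
      rearrangement_def rearrangement_rot_def
    using refl by blast
  then show ?thesis unfolding noetherian_def beta_rot_def by auto
qed

theorem corollary4p6:
  "(\<forall>(n::nat) (L::region set set).
      n \<in> {1, 2, 3} \<and> finite L \<and> (\<forall>P\<in>L. rectangular P)
      \<longrightarrow> strongly_noetherian n L)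
   \<and> (\<forall>(n::nat) (L::region set set).
      finite L \<and> (\<forall>P\<in>L. rectangular P) \<and>
      (\<forall>h w. rect_polyomino h w \<in> L \<longrightarrow> h = 1 \<or> h \<ge> n - 1)
      \<longrightarrow> strongly_noetherian n L)
   \<and> (\<forall>L::region set set.
      finite L \<and> (\<forall>P\<in>L. rectangular P) \<and>
      (\<forall>w w'. rect_polyomino 2 w \<in> L \<and> rect_polyomino 2 w' \<in> L \<longrightarrow> w = w')
      \<longrightarrow> noetherian 4 L)"
  by (intro conjI allI impI strongly_noetherian_imp_noetherian; elim conjE;
      rule strongly_noetherian_rectangular; assumption)

end
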